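(* Let $q=3^k$. Then, as $n\to\infty$, $$EGZ(3,\mathbb{F}_{q}^{n},2) \leq \begin{cases} 8.315^{n+o(n)} & \text{for } k=2, \\ 21.802^{n+o(n)} &\text{for } k=3, \\ 58.557^{n+o(n)} &\text{for } k=4, \\ 159.812^{n+o(n)} &\text{for } k=5. \end{cases}$$
   Context: $\mathbb{F}_q^n$ is viewed as a commutative ring with coordinatewise operations. For elements $g_1,\dots,g_t$ of a commutative ring $R$, $e_m(g_1,\dots,g_t)=\sum_{1\leq i_1<\cdots<i_m\leq t}\prod_{j=1}^m g_{i_j}$; in particular $e_2(g_1,g_2,g_3)=g_1g_2+g_2g_3+g_3g_1$. A sequence over $R$ is a finite list of elements of $R$ (repetitions allowed); a subsequence of length $t$ is obtained by choosing $t$ distinct positions. For a finite commutative ring $R$, $EGZ(t,R,m)$ is the smallest positive integer $\ell$ such that every sequence $S$ over $R$ of length $|S|\geq \ell$ contains a subsequence $S'$ of length $t$ with $e_m(S')=0$ in $R$; if no such $\ell$ exists, $EGZ(t,R,m)=\infty$. *)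

theory Defs
  imports "HOL-Analysis.Analysis" "HOL-Library.Function_Algebras" "HOL-Library.Landau_Symbols"
begin

definition esym :: "nat \<Rightarrow> 'r::comm_ring_1 list \<Rightarrow> 'r" where
  "esym m xs = (\<Sum>I\<in>{I. I \<subseteq> {..<length xs} \<and> card I = m}. \<Prod>i\<in>I. xs ! i)"

text \<open>The property defining EGZ: every sequence over R of length at least l
  has a subsequence (t distinct positions, kept in order) whose e_m vanishes.
  The ring R is given as a carrier set inside an ambient commutative ring type,
  closed under the ambient ring operations.\<close>
definition EGZ_prop :: "nat \<Rightarrow> 'r::comm_ring_1 set \<Rightarrow> nat \<Rightarrow> nat \<Rightarrow> bool" where
  "EGZ_prop t R m l \<longleftrightarrow>
     (\<forall>S. set S \<subseteq> R \<and> length S \<ge> l \<longrightarrow>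
        (\<exists>I. I \<subseteq> {..<length S} \<and> card I = t \<and>
             esym m (map (\<lambda>i. S ! i) (sorted_list_of_set I)) = 0))"

definition EGZ :: "nat \<Rightarrow> 'r::comm_ring_1 set \<Rightarrow> nat \<Rightarrow> enat" where
  "EGZ t R m = (if \<exists>l>0. EGZ_prop t R m l
                then enat (LEAST l. l > 0 \<and> EGZ_prop t R m l) else \<infinity>)"

text \<open>F^n as a subring of the pointwise function ring nat => F: vectors
  supported on coordinates 0..n-1, with coordinatewise operations.\<close>
definition Fpow :: "nat \<Rightarrow> (nat \<Rightarrow> 'a::field) set" where
  "Fpow n = {x. \<forall>i\<ge>n. x i = 0}"

end

theory Submission
  imports Defs
begin

text \<open>Every vector occurs at most twice, because \<open>e\<^sub>2(x, x, x) = 3 x\<^sup>2 = 0\<close>. Splitting by support size costs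
  a factor \<open>n + 1\<close> and makes the problem diagonal: \<open>e\<^sub>2(x, x, y) = x (x - y)\<close>, so its vanishing
  forces \<open>y\<close> to agree with \<open>x\<close> on the support of \<open>x\<close>, and then \<open>x = y\<close> if the supports have equal
  size. The slice rank of the \<open>n\<close>-th tensor power of the indicator of \<open>e\<^sub>2 = 0\<close> on the field bounds
  each part. Away from \<open>0\<close> that indicator is \<open>1 - (1/x + 1/y + 1/z)\<^bsup>q - 1\<^esup>\<close>, which by Frobenius expands
  into monomials in the inverses with ternary digit sums of total at most \<open>2 k\<close>, as for cap sets in
  \<open>k\<close> dimensions; the solutions involving \<open>0\<close> are those with two zero entries, and contribute products of
  the indicator \<open>\<delta>\<close> of \<open>0\<close>. Giving \<open>\<delta>\<close> the weight \<open>2 k / 3\<close> leaves the total bound intact, and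
  counting low-weight words with \<open>t = u\<^sup>3\<close> yields the growth rate
  \<open>1 + ((1 + t + t\<^sup>2)\<^sup>k - t\<^bsup>2k\<^esup>) / t\<^bsup>2k/3\<^esup>\<close>, which is strictly below the claimed constants for suitable \<open>t\<close>.\<close>

section \<open>Slice rank of diagonal tensors\<close>

text \<open>Gaussian elimination, one coordinate \<open>i\<close> at a time: the vectors
  \<open>(f i x)\<close> live in dimension \<open>card I\<close>, so at most that many of them span
  the rest.\<close>

lemma spanning_rows:
  fixes f :: "'i \<Rightarrow> 'b \<Rightarrow> 'a::field"
  assumes "finite I" and "finite A"
  shows "\<exists>B c. B \<subseteq> A \<and> card B \<le> card I \<and>
           (\<forall>x\<in>A - B. \<forall>i\<in>I. f i x = (\<Sum>b\<in>B. c x b * f i b))"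
  using assms
proof (induction I arbitrary: f A rule: finite_induct)
  case empty
  then show ?case by (intro exI[of _ "{}"]) auto
next
  case (insert i0 I)
  show ?case
  proof (cases "\<forall>x\<in>A. f i0 x = 0")
    case True
    from insert.IH[OF insert.prems, of f] obtain B c where "B \<subseteq> A" "card B \<le> card I"
      "\<forall>x\<in>A - B. \<forall>i\<in>I. f i x = (\<Sum>b\<in>B. c x b * f i b)" by blast
    moreover have "(\<Sum>b\<in>B. c x b * f i0 b) = 0" for x
      using True \<open>B \<subseteq> A\<close> by (intro sum.neutral) auto
    ultimately show ?thesis
      using True insert.hyps by (intro exI[of _ B] exI[of _ c]) auto
  next
    case False
    then obtain a where a: "a \<in> A" "f i0 a \<noteq> 0" by blast
    \<comment> \<open>Subtracting a multiple of the pivot vector at \<open>a\<close> clears the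
      coordinate \<open>i0\<close>.\<close>
    define g where "g i x = f i x - f i0 x / f i0 a * f i a" for i x
    from insert.IH[of "A - {a}" g] insert.prems obtain B c where B: "B \<subseteq> A - {a}" "card B \<le> card I"
      and c: "\<And>x i. x \<in> A - {a} - B \<Longrightarrow> i \<in> I \<Longrightarrow> g i x = (\<Sum>b\<in>B. c x b * g i b)" by blast
    have fin: "finite B" using B(1) insert.prems finite_subset by blast
    \<comment> \<open>The coordinate \<open>i0\<close> forces the coefficient of the pivot.\<close>
    define d where "d x b = (if b = a then (f i0 x - (\<Sum>b\<in>B. c x b * f i0 b)) / f i0 a else c x b)" for x b
    have "f i x = (\<Sum>b\<in>insert a B. d x b * f i b)" if x: "x \<in> A - insert a B" and i: "i \<in> insert i0 I" for x i
    proof -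
      have "(\<Sum>b\<in>B. d x b * f i b) = (\<Sum>b\<in>B. c x b * f i b)"
        using B(1) by (intro sum.cong) (auto simp: d_def)
      then have *: "(\<Sum>b\<in>insert a B. d x b * f i b) =
          (f i0 x - (\<Sum>b\<in>B. c x b * f i0 b)) / f i0 a * f i a + (\<Sum>b\<in>B. c x b * f i b)"
        using B(1) fin by (subst sum.insert) (auto simp: d_def)
      have "g i x = (\<Sum>b\<in>B. c x b * g i b)"
        using c[of x i] x i a by (cases "i = i0") (auto simp: g_def)
      also have "\<dots> = (\<Sum>b\<in>B. c x b * f i b) - (\<Sum>b\<in>B. c x b * f i0 b) / f i0 a * f i a"
        by (simp add: g_def right_diff_distrib sum_subtractf sum_distrib_right sum_divide_distrib mult.assoc)
      finally show ?thesis
        unfolding * by (simp add: g_def algebra_simps diff_divide_distrib)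
    qed
    moreover have "card (insert a B) \<le> card (insert i0 I)"
      using B(2) insert.hyps fin by (simp add: card_insert_if)
    ultimately show ?thesis
      using B(1) a(1) by (intro exI[of _ "insert a B"] exI[of _ d]) blast
  qed
qed

text \<open>Every point outside the spanning set \<open>B\<close> yields a linear relation. The sum
  of these relations has coefficient 1 at all such points, so it can vanish only within
  \<open>B\<close>.\<close>

lemma large_support_annihilator:
  fixes f :: "'i \<Rightarrow> 'b \<Rightarrow> 'a::field"
  assumes "finite I" and "finite A"
  shows "\<exists>h. (\<forall>i\<in>I. (\<Sum>x\<in>A. h x * f i x) = 0) \<and> card A \<le> card {x \<in> A. h x \<noteq> 0} + card I"
proof -
  obtain B c where B: "B \<subseteq> A" "card B \<le> card I"
    and c: "\<And>x i. x \<in> A - B \<Longrightarrow> i \<in> I \<Longrightarrow> f i x = (\<Sum>b\<in>B. c x b * f i b)"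
    using spanning_rows[OF assms, of f] by blast
  define h where "h x = (if x \<in> B then - (\<Sum>a\<in>A - B. c a x) else 1)" for x
  have "(\<Sum>x\<in>A. h x * f i x) = 0" if "i \<in> I" for i
  proof -
    have "(\<Sum>x\<in>A. h x * f i x) = (\<Sum>x\<in>A - B. h x * f i x) + (\<Sum>x\<in>B. h x * f i x)"
      using B(1) assms(2) by (metis sum.subset_diff)
    also have "(\<Sum>x\<in>A - B. h x * f i x) = (\<Sum>a\<in>A - B. \<Sum>b\<in>B. c a b * f i b)"
      using c that by (intro sum.cong) (auto simp: h_def)
    also have "\<dots> = (\<Sum>b\<in>B. \<Sum>a\<in>A - B. c a b * f i b)" by (rule sum.swap)
    also have "(\<Sum>x\<in>B. h x * f i x) = - (\<Sum>b\<in>B. \<Sum>a\<in>A - B. c a b * f i b)"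
      by (simp add: h_def sum_distrib_right flip: sum_negf)
    finally show ?thesis by simp
  qed
  moreover have "card A \<le> card {x \<in> A. h x \<noteq> 0} + card I"
  proof -
    have "card A \<le> card (A - B) + card B"
      using B(1) assms(2) by (metis card_Diff_subset card_mono finite_subset le_add_diff_inverse2 order_refl)
    also have "card (A - B) \<le> card {x \<in> A. h x \<noteq> 0}"
      using assms(2) by (intro card_mono) (auto simp: h_def)
    finally show ?thesis using B(2) by linarith
  qed
  ultimately show ?thesis by blast
qed

text \<open>Tao's slice rank argument. Contracting the first variable against an annihilator
  \<open>h\<close> of all \<open>f\<^sub>1 i\<close> kills those slices and leaves a diagonal matrix
  with at least \<open>card A - card I\<close> nonzero entries and rank at most
  \<open>card J + card K\<close>.\<close>

lemma card_le_slice_rank: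
  fixes F :: "'b \<Rightarrow> 'b \<Rightarrow> 'b \<Rightarrow> 'a::field"
    and f\<^sub>1 :: "'i \<Rightarrow> 'b \<Rightarrow> 'a" and f\<^sub>2 :: "'j \<Rightarrow> 'b \<Rightarrow> 'a" and f\<^sub>3 :: "'k \<Rightarrow> 'b \<Rightarrow> 'a"
  assumes fin: "finite A" "finite I" "finite J" "finite K"
    and F: "\<And>x y z. x \<in> A \<Longrightarrow> y \<in> A \<Longrightarrow> z \<in> A \<Longrightarrow>
        F x y z = (\<Sum>i\<in>I. f\<^sub>1 i x * g\<^sub>1 i y z) + (\<Sum>j\<in>J. f\<^sub>2 j y * g\<^sub>2 j x z) + (\<Sum>k\<in>K. f\<^sub>3 k z * g\<^sub>3 k x y)"
    and diag: "\<And>x y z. x \<in> A \<Longrightarrow> y \<in> A \<Longrightarrow> z \<in> A \<Longrightarrow> F x y z \<noteq> 0 \<longleftrightarrow> x = y \<and> y = z"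
  shows "card A \<le> card I + card J + card K"
proof -
  obtain h where h: "\<And>i. i \<in> I \<Longrightarrow> (\<Sum>x\<in>A. h x * f\<^sub>1 i x) = 0"
    and cardA: "card A \<le> card {x \<in> A. h x \<noteq> 0} + card I"
    using large_support_annihilator[OF fin(2,1), of f\<^sub>1] by blast
  define S where "S = {x \<in> A. h x \<noteq> 0}"
  \<comment> \<open>After contraction each remaining slice is a rank-one matrix; \<open>u\<close>
    and \<open>v\<close> are its factors.\<close>
  define u where "u = case_sum f\<^sub>2 (\<lambda>k y. \<Sum>x\<in>A. h x * g\<^sub>3 k x y)"
  define v where "v = case_sum (\<lambda>j z. \<Sum>x\<in>A. h x * g\<^sub>2 j x z) f\<^sub>3"
  have M: "(\<Sum>x\<in>A. h x * F x y z) = (\<Sum>i\<in>J <+> K. u i y * v i z)" if yz: "y \<in> A" "z \<in> A" for y z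
  proof -
    have "(\<Sum>x\<in>A. h x * F x y z) = (\<Sum>x\<in>A. \<Sum>i\<in>I. h x * (f\<^sub>1 i x * g\<^sub>1 i y z)) +
        (\<Sum>x\<in>A. \<Sum>j\<in>J. h x * (f\<^sub>2 j y * g\<^sub>2 j x z)) + (\<Sum>x\<in>A. \<Sum>k\<in>K. h x * (f\<^sub>3 k z * g\<^sub>3 k x y))"
      using yz by (simp add: F distrib_left sum.distrib sum_distrib_left)
    also have "(\<Sum>x\<in>A. \<Sum>i\<in>I. h x * (f\<^sub>1 i x * g\<^sub>1 i y z)) = (\<Sum>i\<in>I. (\<Sum>x\<in>A. h x * f\<^sub>1 i x) * g\<^sub>1 i y z)"
      by (subst sum.swap) (simp add: sum_distrib_right mult.assoc)
    also have "\<dots> = 0" using h by simp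
    also have "(\<Sum>x\<in>A. \<Sum>j\<in>J. h x * (f\<^sub>2 j y * g\<^sub>2 j x z)) = (\<Sum>j\<in>J. u (Inl j) y * v (Inl j) z)"
      by (subst sum.swap) (simp add: u_def v_def sum_distrib_left mult_ac)
    also have "(\<Sum>x\<in>A. \<Sum>k\<in>K. h x * (f\<^sub>3 k z * g\<^sub>3 k x y)) = (\<Sum>k\<in>K. u (Inr k) y * v (Inr k) z)"
      by (subst sum.swap) (simp add: u_def v_def sum_distrib_left mult_ac)
    finally show ?thesis
      using fin by (simp add: sum.Plus)
  qed
  have M_diag: "(\<Sum>x\<in>A. h x * F x y z) = (if y = z then h y * F y y y else 0)" if "y \<in> A" "z \<in> A" for y z
  proof -
    have "(\<Sum>x\<in>A. h x * F x y z) = (\<Sum>x\<in>A. if x = y then (if y = z then h y * F y y y else 0) else 0)"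
      using diag that by (intro sum.cong) auto
    then show ?thesis using that fin by simp
  qed
  have "card S \<le> card (J <+> K)"
  proof (rule ccontr)
    assume less: "\<not> card S \<le> card (J <+> K)"
    have "finite S" using fin by (simp add: S_def)
    then obtain h' where h': "\<And>i. i \<in> J <+> K \<Longrightarrow> (\<Sum>y\<in>S. h' y * u i y) = 0"
      and "card S \<le> card {y \<in> S. h' y \<noteq> 0} + card (J <+> K)"
      using large_support_annihilator[of "J <+> K" S u] fin by auto
    then have "{y \<in> S. h' y \<noteq> 0} \<noteq> {}" using less by force
    then obtain z where z: "z \<in> S" "h' z \<noteq> 0" by blast
    then have zA: "z \<in> A" "h z \<noteq> 0" by (auto simp: S_def)
    \<comment> \<open>Pairing \<open>h'\<close> with column \<open>z\<close> isolates a nonzero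
      diagonal entry, although \<open>h'\<close> annihilates every \<open>u i\<close>.\<close>
    have "h' z * (h z * F z z z) = (\<Sum>y\<in>S. h' y * (\<Sum>x\<in>A. h x * F x y z))"
    proof -
      have "(\<Sum>y\<in>S. h' y * (\<Sum>x\<in>A. h x * F x y z)) = (\<Sum>y\<in>S. if y = z then h' z * (h z * F z z z) else 0)"
        using M_diag zA by (intro sum.cong) (auto simp: S_def)
      then show ?thesis using z \<open>finite S\<close> by simp
    qed
    also have "\<dots> = (\<Sum>y\<in>S. \<Sum>i\<in>J <+> K. h' y * (u i y * v i z))"
      using M zA by (intro sum.cong) (auto simp: S_def sum_distrib_left)
    also have "\<dots> = (\<Sum>i\<in>J <+> K. (\<Sum>y\<in>S. h' y * u i y) * v i z)"
      by (subst sum.swap) (simp add: sum_distrib_right mult.assoc)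
    also have "\<dots> = 0" using h' by simp
    finally show False using z zA diag[of z z z] by simp
  qed
  then show ?thesis using cardA fin by (simp add: S_def card_Plus)
qed

section \<open>Tensors of low weight and their powers\<close>

definition low_triples :: "'i set \<Rightarrow> ('i \<Rightarrow> nat) \<Rightarrow> nat \<Rightarrow> ('i \<times> 'i \<times> 'i) set" where
  "low_triples X W M = {(i, j, k). i \<in> X \<and> j \<in> X \<and> k \<in> X \<and> W i + W j + W k \<le> M}"

text \<open>The span of the monomials within a total weight budget \<open>M\<close>; being a span,
  it allows a tensor to be checked term by term.\<close>

definition low_tensor ::
    "'i set \<Rightarrow> ('i \<Rightarrow> 'a \<Rightarrow> 'a) \<Rightarrow> ('i \<Rightarrow> nat) \<Rightarrow> nat \<Rightarrow> ('a \<Rightarrow> 'a \<Rightarrow> 'a \<Rightarrow> 'a::field) \<Rightarrow> bool" where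
  "low_tensor X \<phi> W M T \<longleftrightarrow>
     (\<exists>c. \<forall>x y z. T x y z = (\<Sum>(i, j, k)\<in>low_triples X W M. c (i, j, k) * (\<phi> i x * \<phi> j y * \<phi> k z)))"

lemma finite_low_triples: "finite X \<Longrightarrow> finite (low_triples X W M)"
  by (rule finite_subset[of _ "X \<times> X \<times> X"]) (auto simp: low_triples_def)

lemma low_tensor_zero: "low_tensor X \<phi> W M (\<lambda>x y z. 0)"
  unfolding low_tensor_def by (intro exI[of _ "\<lambda>_. 0"]) auto

lemma low_tensor_add:
  assumes "low_tensor X \<phi> W M S" and "low_tensor X \<phi> W M T"
  shows "low_tensor X \<phi> W M (\<lambda>x y z. S x y z + T x y z)"
proof -
  obtain c d where
    "\<And>x y z. S x y z = (\<Sum>(i, j, k)\<in>low_triples X W M. c (i, j, k) * (\<phi> i x * \<phi> j y * \<phi> k z))"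
    "\<And>x y z. T x y z = (\<Sum>(i, j, k)\<in>low_triples X W M. d (i, j, k) * (\<phi> i x * \<phi> j y * \<phi> k z))"
    using assms unfolding low_tensor_def by blast
  then show ?thesis unfolding low_tensor_def
    by (intro exI[of _ "\<lambda>s. c s + d s"])
      (simp add: distrib_right split_def flip: sum.distrib)
qed

lemma low_tensor_uminus:
  assumes "low_tensor X \<phi> W M T"
  shows "low_tensor X \<phi> W M (\<lambda>x y z. - T x y z)"
proof -
  obtain c where
    "\<And>x y z. T x y z = (\<Sum>(i, j, k)\<in>low_triples X W M. c (i, j, k) * (\<phi> i x * \<phi> j y * \<phi> k z))"
    using assms unfolding low_tensor_def by blast
  then show ?thesis unfolding low_tensor_def
    by (intro exI[of _ "\<lambda>s. - c s"]) (simp add: split_def flip: sum_negf)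
qed

lemma low_tensor_sum:
  assumes "\<And>s. s \<in> S \<Longrightarrow> low_tensor X \<phi> W M (T s)"
  shows "low_tensor X \<phi> W M (\<lambda>x y z. \<Sum>s\<in>S. T s x y z)"
  using assms
  by (induction S rule: infinite_finite_induct) (auto intro: low_tensor_zero low_tensor_add)

lemma low_tensor_monomial:
  assumes "finite X" and "i \<in> X" "j \<in> X" "k \<in> X" and "W i + W j + W k \<le> M"
  shows "low_tensor X \<phi> W M (\<lambda>x y z. \<phi> i x * \<phi> j y * \<phi> k z)"
proof -
  have "(i, j, k) \<in> low_triples X W M" using assms by (simp add: low_triples_def)
  then have "(\<Sum>s\<in>low_triples X W M. if s = (i, j, k) then \<phi> i x * \<phi> j y * \<phi> k z else 0)
      = \<phi> i x * \<phi> j y * \<phi> k z" for x y z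
    using finite_low_triples[OF assms(1)] by simp
  moreover have "(\<Sum>(i', j', k')\<in>low_triples X W M.
        (if (i', j', k') = (i, j, k) then 1 else 0) * (\<phi> i' x * \<phi> j' y * \<phi> k' z))
      = (\<Sum>s\<in>low_triples X W M. if s = (i, j, k) then \<phi> i x * \<phi> j y * \<phi> k z else 0)" for x y z
    by (intro sum.cong) (auto split: if_splits)
  ultimately show ?thesis
    unfolding low_tensor_def
    by (intro exI[of _ "\<lambda>s. if s = (i, j, k) then 1 else 0"]) simp
qed

definition low_words :: "'i set \<Rightarrow> ('i \<Rightarrow> nat) \<Rightarrow> nat \<Rightarrow> nat \<Rightarrow> (nat \<Rightarrow> 'i) set" where
  "low_words X W m n = {p \<in> {..<n} \<rightarrow>\<^sub>E X. (\<Sum>l<n. W (p l)) \<le> m * n}"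

lemma finite_low_words: "finite X \<Longrightarrow> finite (low_words X W m n)"
  unfolding low_words_def by (rule finite_subset[of _ "{..<n} \<rightarrow>\<^sub>E X"]) (auto intro: finite_PiE)

text \<open>Chernoff-type bound: a low word contributes at least \<open>u ^ (m * n)\<close> because
  \<open>u \<le> 1\<close>, and the sum over all words factors over the letters.\<close>

lemma card_low_words_le:
  fixes u :: real
  assumes "finite X" and u: "0 < u" "u \<le> 1"
  shows "real (card (low_words X W m n)) \<le> ((\<Sum>i\<in>X. u ^ W i) / u ^ m) ^ n"
proof -
  have "real (card (low_words X W m n)) * u ^ (m * n) = (\<Sum>p\<in>low_words X W m n. u ^ (m * n))"
    by simp
  also have "\<dots> \<le> (\<Sum>p\<in>low_words X W m n. \<Prod>l<n. u ^ W (p l))"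
  proof (rule sum_mono)
    fix p assume "p \<in> low_words X W m n"
    then have "(\<Sum>l<n. W (p l)) \<le> m * n" by (simp add: low_words_def)
    then have "u ^ (m * n) \<le> u ^ (\<Sum>l<n. W (p l))" using u by (intro power_decreasing) auto
    then show "u ^ (m * n) \<le> (\<Prod>l<n. u ^ W (p l))" by (simp only: power_sum)
  qed
  also have "\<dots> \<le> (\<Sum>p\<in>{..<n} \<rightarrow>\<^sub>E X. \<Prod>l<n. u ^ W (p l))"
    using assms by (intro sum_mono2 finite_PiE prod_nonneg) (auto simp: low_words_def)
  also have "\<dots> = (\<Prod>l<n. \<Sum>i\<in>X. u ^ W i)"
    using assms by (subst prod_sum_PiE) auto
  finally show ?thesis
    using u by (simp add: field_simps power_divide power_mult)
qed

text \<open>In a product of \<open>n\<close> triples of total weight at most \<open>3 m\<close>, one of the three words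
  has weight at most \<open>m n\<close>.\<close>

lemma card_le_low_tensor_power:
  fixes A :: "(nat \<Rightarrow> 'a::field) set" and X :: "'i set"
  assumes "finite X" and "finite A" and T: "low_tensor X \<phi> W (3 * m) T"
    and diag: "\<And>x y z. x \<in> A \<Longrightarrow> y \<in> A \<Longrightarrow> z \<in> A \<Longrightarrow>
      (\<forall>l<n. T (x l) (y l) (z l) \<noteq> 0) \<longleftrightarrow> x = y \<and> y = z"
  shows "card A \<le> 3 * card (low_words X W m n)"
proof -
  define G where "G = low_triples X W (3 * m)"
  define L where "L = low_words X W m n"
  define P where "P = ({..<n} \<rightarrow>\<^sub>E G)"
  define \<pi> :: "('i \<times> 'i \<times> 'i \<Rightarrow> 'i) \<Rightarrow> (nat \<Rightarrow> 'i \<times> 'i \<times> 'i) \<Rightarrow> nat \<Rightarrow> 'i"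
    where "\<pi> p s = (\<lambda>l\<in>{..<n}. p (s l))" for p s
  define p\<^sub>1 p\<^sub>2 p\<^sub>3 :: "'i \<times> 'i \<times> 'i \<Rightarrow> 'i"
    where p_def: "p\<^sub>1 = fst" "p\<^sub>2 = fst \<circ> snd" "p\<^sub>3 = snd \<circ> snd"
  define \<Phi> where "\<Phi> p x = (\<Prod>l<n. \<phi> (p l) (x l))" for p and x :: "nat \<Rightarrow> 'a"
  obtain c where c: "\<And>x y z. T x y z = (\<Sum>(i, j, k)\<in>G. c (i, j, k) * (\<phi> i x * \<phi> j y * \<phi> k z))"
    using T unfolding low_tensor_def G_def by blast
  define C where "C s = (\<Prod>l<n. c (s l))" for s
  define t where "t s x y z = C s * (\<Phi> (\<pi> p\<^sub>1 s) x * \<Phi> (\<pi> p\<^sub>2 s) y * \<Phi> (\<pi> p\<^sub>3 s) z)" for s x y z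
  have fin: "finite G" "finite P" "finite L"
    using assms(1) by (auto simp: G_def P_def L_def intro: finite_low_triples finite_PiE finite_low_words)
  \<comment> \<open>Each monomial of the product is charged to the first variable whose word is
    low.\<close>
  define P\<^sub>1 where "P\<^sub>1 = {s \<in> P. \<pi> p\<^sub>1 s \<in> L}"
  define P\<^sub>2 where "P\<^sub>2 = {s \<in> P - P\<^sub>1. \<pi> p\<^sub>2 s \<in> L}"
  define P\<^sub>3 where "P\<^sub>3 = P - P\<^sub>1 - P\<^sub>2"
  have P\<^sub>3: "\<pi> p\<^sub>3 s \<in> L" if "s \<in> P\<^sub>3" for s
  proof -
    have s: "s l \<in> G" if "l < n" for l using \<open>s \<in> P\<^sub>3\<close> that by (auto simp: P\<^sub>3_def P_def)
    have G: "p\<^sub>1 g \<in> X" "p\<^sub>2 g \<in> X" "p\<^sub>3 g \<in> X" "W (p\<^sub>1 g) + W (p\<^sub>2 g) + W (p\<^sub>3 g) \<le> 3 * m" if "g \<in> G" for g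
      using that by (auto simp: G_def low_triples_def p_def)
    have words: "\<pi> p\<^sub>1 s \<in> {..<n} \<rightarrow>\<^sub>E X" "\<pi> p\<^sub>2 s \<in> {..<n} \<rightarrow>\<^sub>E X" "\<pi> p\<^sub>3 s \<in> {..<n} \<rightarrow>\<^sub>E X"
      using s G unfolding \<pi>_def by (auto intro!: restrict_PiE)
    have "(\<Sum>l<n. W (\<pi> p\<^sub>1 s l)) + (\<Sum>l<n. W (\<pi> p\<^sub>2 s l)) + (\<Sum>l<n. W (\<pi> p\<^sub>3 s l))
        = (\<Sum>l<n. W (p\<^sub>1 (s l)) + W (p\<^sub>2 (s l)) + W (p\<^sub>3 (s l)))"
      by (simp add: \<pi>_def sum.distrib)
    also have "\<dots> \<le> (\<Sum>l<n. 3 * m)"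
      using s by (intro sum_mono) (simp add: G)
    finally have "(\<Sum>l<n. W (\<pi> p\<^sub>1 s l)) + (\<Sum>l<n. W (\<pi> p\<^sub>2 s l)) + (\<Sum>l<n. W (\<pi> p\<^sub>3 s l)) \<le> 3 * (m * n)"
      by (simp add: mult_ac)
    moreover have "\<not> (\<Sum>l<n. W (\<pi> p\<^sub>1 s l)) \<le> m * n" "\<not> (\<Sum>l<n. W (\<pi> p\<^sub>2 s l)) \<le> m * n"
      using that words by (auto simp: P\<^sub>3_def P\<^sub>2_def P\<^sub>1_def L_def low_words_def)
    ultimately have "(\<Sum>l<n. W (\<pi> p\<^sub>3 s l)) \<le> m * n" by linarith
    then show ?thesis using words by (simp add: L_def low_words_def)
  qed
  have prod_eq: "(\<Prod>l<n. T (x l) (y l) (z l)) =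
      (\<Sum>p\<in>L. \<Phi> p x * (\<Sum>s\<in>{s \<in> P\<^sub>1. \<pi> p\<^sub>1 s = p}. C s * (\<Phi> (\<pi> p\<^sub>2 s) y * \<Phi> (\<pi> p\<^sub>3 s) z))) +
      (\<Sum>p\<in>L. \<Phi> p y * (\<Sum>s\<in>{s \<in> P\<^sub>2. \<pi> p\<^sub>2 s = p}. C s * (\<Phi> (\<pi> p\<^sub>1 s) x * \<Phi> (\<pi> p\<^sub>3 s) z))) +
      (\<Sum>p\<in>L. \<Phi> p z * (\<Sum>s\<in>{s \<in> P\<^sub>3. \<pi> p\<^sub>3 s = p}. C s * (\<Phi> (\<pi> p\<^sub>1 s) x * \<Phi> (\<pi> p\<^sub>2 s) y)))" for x y z
  proof -
    have "(\<Prod>l<n. T (x l) (y l) (z l)) =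
        (\<Sum>s\<in>P. \<Prod>l<n. c (s l) * (\<phi> (p\<^sub>1 (s l)) (x l) * \<phi> (p\<^sub>2 (s l)) (y l) * \<phi> (p\<^sub>3 (s l)) (z l)))"
      unfolding c P_def split_def using fin by (subst prod_sum_PiE) (auto simp: p_def)
    also have "\<dots> = (\<Sum>s\<in>P. t s x y z)"
      by (simp add: t_def C_def \<Phi>_def \<pi>_def prod.distrib)
    also have "\<dots> = (\<Sum>s\<in>P\<^sub>1. t s x y z) + (\<Sum>s\<in>P\<^sub>2. t s x y z) + (\<Sum>s\<in>P\<^sub>3. t s x y z)"
    proof -
      have "P\<^sub>1 \<subseteq> P" "P\<^sub>2 \<subseteq> P - P\<^sub>1" by (auto simp: P\<^sub>1_def P\<^sub>2_def)
      then show ?thesis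
        using fin sum.subset_diff[of P\<^sub>1 P "\<lambda>s. t s x y z"] sum.subset_diff[of P\<^sub>2 "P - P\<^sub>1" "\<lambda>s. t s x y z"]
        by (simp add: P\<^sub>3_def add_ac)
    qed
    \<comment> \<open>Terms sharing their low word \<open>p\<close> merge into one slice with factor
      \<open>\<Phi> p\<close>, so each variable needs only \<open>card L\<close> slices.\<close>
    also have "(\<Sum>s\<in>P\<^sub>1. t s x y z) = (\<Sum>p\<in>L. \<Sum>s\<in>{s \<in> P\<^sub>1. \<pi> p\<^sub>1 s = p}. t s x y z)"
      using fin by (intro sum.group[symmetric]) (auto simp: P\<^sub>1_def)
    also have "(\<Sum>s\<in>P\<^sub>2. t s x y z) = (\<Sum>p\<in>L. \<Sum>s\<in>{s \<in> P\<^sub>2. \<pi> p\<^sub>2 s = p}. t s x y z)"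
      using fin by (intro sum.group[symmetric]) (auto simp: P\<^sub>2_def)
    also have "(\<Sum>s\<in>P\<^sub>3. t s x y z) = (\<Sum>p\<in>L. \<Sum>s\<in>{s \<in> P\<^sub>3. \<pi> p\<^sub>3 s = p}. t s x y z)"
      using fin P\<^sub>3 by (intro sum.group[symmetric]) (auto simp: P\<^sub>3_def)
    finally show ?thesis
      by (simp add: t_def sum_distrib_left mult_ac)
  qed
  have "card A \<le> card L + card L + card L"
  proof (rule card_le_slice_rank[OF assms(2) fin(3) fin(3) fin(3)])
    show "(\<Prod>l<n. T (x l) (y l) (z l)) \<noteq> 0 \<longleftrightarrow> x = y \<and> y = z"
      if "x \<in> A" "y \<in> A" "z \<in> A" for x y z
      using diag[OF that] by (simp add: Ball_def)
  qed (rule prod_eq)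
  then show ?thesis by (simp add: L_def)
qed

section \<open>Powers in fields of characteristic 3\<close>

text \<open>Multiplication by \<open>x\<close> permutes the nonzero elements and so preserves their
  product.\<close>

lemma power_card_minus_one_eq_one:
  fixes x :: "'a::{field,finite}"
  assumes "x \<noteq> 0"
  shows "x ^ (CARD('a) - 1) = 1"
proof -
  have "(\<Prod>y\<in>- {0}. x * y) = (\<Prod>y\<in>- {0}. y)"
    using assms
    by (intro prod.reindex_bij_witness[of _ "\<lambda>y. y / x" "\<lambda>y. x * y"]) auto
  then have "x ^ card (- {0::'a}) * (\<Prod>y\<in>- {0}. y) = (\<Prod>y\<in>- {0}. y)"
    by (simp add: prod.distrib)
  moreover have "(\<Prod>y\<in>- {0::'a}. y) \<noteq> 0" by simp
  ultimately have "x ^ card (- {0::'a}) = 1"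
    by (metis mult_cancel_right1)
  then show ?thesis by (simp add: Compl_eq_Diff_UNIV)
qed

text \<open>Translation by 1 preserves the sum of all elements. For a field of \<open>3 ^ k\<close>
  elements this yields characteristic 3.\<close>

lemma of_nat_card_eq_zero: "of_nat CARD('a) = (0::'a::{ring_1,finite})"
proof -
  have "(\<Sum>y\<in>UNIV. y + 1) = (\<Sum>y\<in>UNIV. y::'a)"
    by (intro sum.reindex_bij_witness[of _ "\<lambda>y. y - 1" "\<lambda>y. y + 1"]) auto
  then show ?thesis by (simp add: sum.distrib)
qed

lemma frobenius_power_add:
  fixes a b :: "'a::comm_ring_1"
  assumes "(3::'a) = 0"
  shows "(a + b) ^ 3 ^ j = a ^ 3 ^ j + b ^ 3 ^ j"
proof (induction j)
  case (Suc j)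
  have cube: "(c + d) ^ 3 = c ^ 3 + d ^ 3" for c d :: 'a
  proof -
    have "(c + d) ^ 3 = c ^ 3 + d ^ 3 + 3 * (c * c * d + c * d * d)"
      by (simp add: power3_eq_cube algebra_simps)
    then show ?thesis using assms by simp
  qed
  have "(a + b) ^ 3 ^ Suc j = ((a + b) ^ 3 ^ j) ^ 3"
    by (simp add: mult.commute flip: power_mult)
  also have "\<dots> = (a ^ 3 ^ j) ^ 3 + (b ^ 3 ^ j) ^ 3"
    unfolding Suc cube ..
  finally show ?case
    by (simp add: mult.commute flip: power_mult)
qed simp

text \<open>All \<open>k\<close> ternary digits of \<open>3 ^ k - 1\<close> are 2; in this form
  Frobenius applies to each factor.\<close>

lemma power_three_power_minus_one:
  fixes w :: "'a::comm_monoid_mult"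
  shows "w ^ (3 ^ k - 1) = (\<Prod>j<k. (w ^ 3 ^ j)\<^sup>2)"
proof (induction k)
  case (Suc k)
  have "w ^ (3 ^ Suc k - 1) = w ^ ((3 ^ k - 1) + 2 * 3 ^ k)"
    by (intro arg_cong[of _ _ "power w"]) simp
  also have "\<dots> = (\<Prod>j<k. (w ^ 3 ^ j)\<^sup>2) * (w ^ 3 ^ k)\<^sup>2"
    by (simp only: power_add Suc power_mult[symmetric] mult.commute)
  finally show ?case by simp
qed simp

definition pair_count :: "nat \<Rightarrow> nat \<times> nat \<Rightarrow> nat" where
  "pair_count i p = (if fst p = i then 1 else 0) + (if snd p = i then 1 else 0)"

text \<open>Summing over ordered pairs, with one variable picked from each of the two factors, makes
  every coefficient 1.\<close>

lemma square_trinomial: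
  fixes a b c :: "'a::comm_semiring_1"
  shows "(a + b + c)\<^sup>2 = (\<Sum>p\<in>{..<3} \<times> {..<3}. a ^ pair_count 0 p * b ^ pair_count 1 p * c ^ pair_count 2 p)"
  unfolding sum.cartesian_product'
  by (simp add: pair_count_def numeral_3_eq_3 power2_eq_square algebra_simps)

section \<open>The vanishing of \<open>e_2\<close> as a tensor of low weight\<close>

text \<open>An exponent below \<open>3\<^sup>k\<close> is represented by its \<open>k\<close> ternary digits. The all-twos digit word is left
  out of the basis, since its monomial \<open>x\<^bsup>-(q - 1)\<^esup>\<close> equals \<open>1\<close> away from \<open>0\<close>; the index \<open>None\<close>
  stands for the indicator of \<open>0\<close>. Weights are digit sums scaled by \<open>3\<close>, so that \<open>2 k\<close>, the largest
  weight of the indicator for which its cube stays within the total \<open>6 k\<close>, is an integer.\<close>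

definition digits :: "nat \<Rightarrow> (nat \<Rightarrow> nat) set" where
  "digits k = ({..<k} \<rightarrow>\<^sub>E {..2})"

definition top_digits :: "nat \<Rightarrow> nat \<Rightarrow> nat" where
  "top_digits k = (\<lambda>j\<in>{..<k}. 2)"

definition zero_digits :: "nat \<Rightarrow> nat \<Rightarrow> nat" where
  "zero_digits k = (\<lambda>j\<in>{..<k}. 0)"

definition expo :: "nat \<Rightarrow> (nat \<Rightarrow> nat) \<Rightarrow> nat" where
  "expo k d = (\<Sum>j<k. 3 ^ j * d j)"

definition inv_monomial :: "nat \<Rightarrow> (nat \<Rightarrow> nat) \<Rightarrow> 'a \<Rightarrow> 'a::field" where
  "inv_monomial k d x = (if x = 0 then 0 else inverse x ^ expo k d)"

definition basis_index :: "nat \<Rightarrow> (nat \<Rightarrow> nat) option set" where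
  "basis_index k = insert None (Some ` (digits k - {top_digits k}))"

primrec basis_fun :: "nat \<Rightarrow> (nat \<Rightarrow> nat) option \<Rightarrow> 'a \<Rightarrow> 'a::field" where
  "basis_fun k None = (\<lambda>x. if x = 0 then 1 else 0)"
| "basis_fun k (Some d) = inv_monomial k d"

primrec weight :: "nat \<Rightarrow> (nat \<Rightarrow> nat) option \<Rightarrow> nat" where
  "weight k None = 2 * k"
| "weight k (Some d) = 3 * (\<Sum>j<k. d j)"

lemma finite_digits [simp]: "finite (digits k)"
  by (simp add: digits_def finite_PiE)

lemma finite_basis_index [simp]: "finite (basis_index k)"
  by (simp add: basis_index_def)

lemma expo_top_digits: "expo k (top_digits k) = 3 ^ k - 1"
proof -
  have "expo k (top_digits k) + 1 = 3 ^ k"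
    by (induction k) (simp_all add: expo_def top_digits_def)
  then show ?thesis by linarith
qed

lemma expo_zero_digits [simp]: "expo k (zero_digits k) = 0"
  by (simp add: expo_def zero_digits_def)

lemma zero_digits_in: "k > 0 \<Longrightarrow> zero_digits k \<in> digits k - {top_digits k}"
  by (auto simp: zero_digits_def digits_def top_digits_def dest!: fun_cong[of _ _ 0])

lemma basis_fun_zero_digits: "basis_fun k (Some (zero_digits k)) x = (if x = 0 then 0 else 1)"
  by (simp add: inv_monomial_def)

text \<open>Over all digit words the sum factors over the \<open>k\<close> digits. The omitted top
  word accounts for \<open>u ^ (6 * k)\<close>, the index \<open>None\<close> for
  \<open>u ^ (2 * k)\<close>.\<close>

lemma sum_power_weight:
  fixes u :: real
  shows "(\<Sum>i\<in>basis_index k. u ^ weight k i) = (1 + u ^ 3 + u ^ 6) ^ k - u ^ (6 * k) + u ^ (2 * k)"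
proof -
  have top: "top_digits k \<in> digits k" by (auto simp: top_digits_def digits_def)
  have "(\<Sum>d\<in>digits k. u ^ (3 * (\<Sum>j<k. d j))) = (\<Sum>d\<in>digits k. \<Prod>j<k. u ^ (3 * d j))"
    by (simp add: power_sum sum_distrib_left)
  also have "\<dots> = (\<Prod>j<k. \<Sum>i\<in>{..2}. u ^ (3 * i))"
    unfolding digits_def by (subst prod_sum_PiE) auto
  also have "\<dots> = (1 + u ^ 3 + u ^ 6) ^ k"
    by (simp add: numeral_2_eq_2 eval_nat_numeral)
  finally have "(\<Sum>d\<in>digits k - {top_digits k}. u ^ (3 * (\<Sum>j<k. d j))) = (1 + u ^ 3 + u ^ 6) ^ k - u ^ (6 * k)"
    using top by (simp add: sum_diff1 top_digits_def mult.commute)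
  then show ?thesis
    by (simp add: basis_index_def sum.insert_if sum.reindex image_iff)
qed

definition e2_indicator :: "'a \<Rightarrow> 'a \<Rightarrow> 'a \<Rightarrow> 'a::field" where
  "e2_indicator x y z = (if x * y + y * z + z * x = 0 then 1 else 0)"

context
  fixes k :: nat and field_type :: "'a::{field,finite} itself"
  assumes card: "CARD('a) = 3 ^ k"
begin

lemma three_eq_zero: "(3::'a) = 0"
  using of_nat_card_eq_zero[where 'a = 'a] card by (simp add: of_nat_power)

lemma k_pos: "k > 0"
proof (rule ccontr)
  assume "\<not> k > 0"
  then have "CARD('a) = 1" using card by simp
  then have "(0::'a) = 1" by (metis (full_types) card_1_singletonE UNIV_I singletonD)
  then show False by simp
qed

lemma inv_monomial_top: "inv_monomial k (top_digits k) (x::'a) = (if x = 0 then 0 else 1)"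
  using power_card_minus_one_eq_one[of "inverse x"] by (simp add: inv_monomial_def expo_top_digits card)

text \<open>The weight is only bounded because the missing top word is replaced by the zero word,
  which gives the same function at weight 0.\<close>

lemma inv_monomial_eq_basis_fun:
  assumes "d \<in> digits k"
  shows "\<exists>i\<in>basis_index k. (inv_monomial k d :: 'a \<Rightarrow> 'a) = basis_fun k i \<and> weight k i \<le> 3 * (\<Sum>j<k. d j)"
proof (cases "d = top_digits k")
  case True
  have "(inv_monomial k d :: 'a \<Rightarrow> 'a) = basis_fun k (Some (zero_digits k))"
    unfolding True by (intro ext) (simp only: inv_monomial_top basis_fun_zero_digits)
  moreover have "Some (zero_digits k) \<in> basis_index k"
    using zero_digits_in[OF k_pos] by (auto simp: basis_index_def)
  moreover have "weight k (Some (zero_digits k)) = 0"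
    by (simp add: zero_digits_def)
  ultimately show ?thesis by (metis le0)
next
  case False
  then show ?thesis using assms by (intro bexI[of _ "Some d"]) (auto simp: basis_index_def)
qed

lemma low_tensor_inv_monomials:
  assumes "d \<in> digits k" "e \<in> digits k" "f \<in> digits k"
    and "(\<Sum>j<k. d j) + (\<Sum>j<k. e j) + (\<Sum>j<k. f j) \<le> 2 * k"
  shows "low_tensor (basis_index k) (basis_fun k) (weight k) (3 * (2 * k))
    (\<lambda>x y z :: 'a. inv_monomial k d x * inv_monomial k e y * inv_monomial k f z)"
proof -
  obtain i j l where "i \<in> basis_index k" "j \<in> basis_index k" "l \<in> basis_index k"
    and eqs: "(inv_monomial k d :: 'a \<Rightarrow> 'a) = basis_fun k i" "(inv_monomial k e :: 'a \<Rightarrow> 'a) = basis_fun k j"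
      "(inv_monomial k f :: 'a \<Rightarrow> 'a) = basis_fun k l"
    and "weight k i \<le> 3 * (\<Sum>j<k. d j)" "weight k j \<le> 3 * (\<Sum>j<k. e j)" "weight k l \<le> 3 * (\<Sum>j<k. f j)"
    using assms(1-3)[THEN inv_monomial_eq_basis_fun] by blast
  then show ?thesis unfolding eqs using assms(4)
    by (intro low_tensor_monomial) auto
qed

text \<open>A word \<open>s\<close> of ordered pairs indexes a term of the expanded power below;
  these are the ternary digits of the exponent of its variable \<open>i\<close>.\<close>

definition pair_digits :: "nat \<Rightarrow> (nat \<Rightarrow> nat \<times> nat) \<Rightarrow> nat \<Rightarrow> nat" where
  "pair_digits i s = (\<lambda>j\<in>{..<k}. pair_count i (s j))"

text \<open>Frobenius turns the power into a product of squared trinomials in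
  \<open>3 ^ j\<close>-th powers, which is then multiplied out.\<close>

lemma sum_power_expansion:
  fixes a b c :: 'a
  shows "(a + b + c) ^ (3 ^ k - 1) = (\<Sum>s\<in>{..<k} \<rightarrow>\<^sub>E {..<3} \<times> {..<3}.
    a ^ expo k (pair_digits 0 s) * b ^ expo k (pair_digits 1 s) * c ^ expo k (pair_digits 2 s))"
proof -
  have "(a + b + c) ^ (3 ^ k - 1) = (\<Prod>j<k. (a ^ 3 ^ j + b ^ 3 ^ j + c ^ 3 ^ j)\<^sup>2)"
    by (simp only: power_three_power_minus_one frobenius_power_add[OF three_eq_zero])
  also have "\<dots> = (\<Sum>s\<in>{..<k} \<rightarrow>\<^sub>E {..<3} \<times> {..<3}. \<Prod>j<k. (a ^ 3 ^ j) ^ pair_count 0 (s j) *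
      (b ^ 3 ^ j) ^ pair_count 1 (s j) * (c ^ 3 ^ j) ^ pair_count 2 (s j))"
    unfolding square_trinomial by (subst prod_sum_PiE) auto
  also have "\<dots> = (\<Sum>s\<in>{..<k} \<rightarrow>\<^sub>E {..<3} \<times> {..<3}.
    a ^ expo k (pair_digits 0 s) * b ^ expo k (pair_digits 1 s) * c ^ expo k (pair_digits 2 s))"
    by (simp add: expo_def pair_digits_def prod.distrib power_sum power_mult)
  finally show ?thesis .
qed

text \<open>If a variable is zero, \<open>e_2\<close> is the product of the other two, so it
  vanishes exactly when at least two variables are zero: these are the four terms with
  \<open>\<delta>\<close>. Otherwise the first two summands form \<open>1 - w ^ (3 ^ k - 1)\<close>,
  where \<open>w\<close>, the sum of the inverses, is \<open>e_2\<close> divided by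
  \<open>x * y * z\<close>.\<close>

lemma e2_indicator_decomposition:
  fixes x y z :: 'a
  defines "\<delta> \<equiv> basis_fun k None" and "e \<equiv> basis_fun k (Some (zero_digits k))"
  shows "e2_indicator x y z =
    e x * e y * e z
    + (- (\<Sum>s\<in>{..<k} \<rightarrow>\<^sub>E {..<3} \<times> {..<3}. inv_monomial k (pair_digits 0 s) x *
        inv_monomial k (pair_digits 1 s) y * inv_monomial k (pair_digits 2 s) z))
    + \<delta> x * \<delta> y * e z + \<delta> x * e y * \<delta> z + e x * \<delta> y * \<delta> z + \<delta> x * \<delta> y * \<delta> z"
proof (cases "x = 0 \<or> y = 0 \<or> z = 0")
  case True
  then have "inv_monomial k d x * inv_monomial k f y * inv_monomial k g z = 0" for d f g
    by (auto simp: inv_monomial_def)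
  then have "(\<Sum>s\<in>{..<k} \<rightarrow>\<^sub>E {..<3} \<times> {..<3}. inv_monomial k (pair_digits 0 s) x *
      inv_monomial k (pair_digits 1 s) y * inv_monomial k (pair_digits 2 s) z) = 0"
    by (intro sum.neutral) blast
  then show ?thesis using True
    by (auto simp: \<delta>_def e_def e2_indicator_def basis_fun_zero_digits simp del: basis_fun.simps(2))
next
  case False
  define w where "w = inverse x + inverse y + inverse z"
  have "(\<Sum>s\<in>{..<k} \<rightarrow>\<^sub>E {..<3} \<times> {..<3}. inv_monomial k (pair_digits 0 s) x *
        inv_monomial k (pair_digits 1 s) y * inv_monomial k (pair_digits 2 s) z) = w ^ (3 ^ k - 1)"
    using False unfolding w_def sum_power_expansion by (simp add: inv_monomial_def)
  moreover have "w ^ (3 ^ k - 1) = (if w = 0 then 0 else 1)"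
    using power_card_minus_one_eq_one[of w] one_less_power[of "3::nat" k] k_pos card by (auto simp: zero_power)
  moreover have "w = 0 \<longleftrightarrow> x * y + y * z + z * x = 0"
  proof -
    have "w * (x * y * z) = x * y + y * z + z * x"
      using False by (simp add: w_def field_simps)
    then show ?thesis using False by (metis mult_eq_0_iff)
  qed
  ultimately show ?thesis using False
    by (simp add: \<delta>_def e_def e2_indicator_def basis_fun_zero_digits del: basis_fun.simps(2))
qed

text \<open>The budget \<open>6 * k\<close> is met: power terms have digit sum at most 2 at each of
  \<open>k\<close> places, scaled by 3; a factor \<open>\<delta>\<close> costs \<open>2 * k\<close>,
  and a factor \<open>e\<close> nothing.\<close>

lemma low_tensor_e2_indicator:
  "low_tensor (basis_index k) (basis_fun k) (weight k) (3 * (2 * k)) (e2_indicator :: 'a \<Rightarrow> 'a \<Rightarrow> 'a \<Rightarrow> 'a)"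
proof -
  have "Some (zero_digits k) \<in> basis_index k" "weight k (Some (zero_digits k)) = 0" "None \<in> basis_index k"
    using zero_digits_in[OF k_pos] by (auto simp: basis_index_def zero_digits_def)
  moreover have "pair_digits i s \<in> digits k" if "s \<in> {..<k} \<rightarrow>\<^sub>E {..<3} \<times> {..<3}" for i s
    by (auto simp: pair_digits_def digits_def pair_count_def)
  moreover have "(\<Sum>j<k. pair_digits 0 s j) + (\<Sum>j<k. pair_digits 1 s j) + (\<Sum>j<k. pair_digits 2 s j) \<le> 2 * k"
    if s: "s \<in> {..<k} \<rightarrow>\<^sub>E {..<3} \<times> {..<3}" for s
  proof -
    have "(\<Sum>j<k. pair_digits 0 s j) + (\<Sum>j<k. pair_digits 1 s j) + (\<Sum>j<k. pair_digits 2 s j)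
        = (\<Sum>j<k. pair_count 0 (s j) + pair_count 1 (s j) + pair_count 2 (s j))"
      by (simp add: pair_digits_def sum.distrib)
    also have "\<dots> \<le> (\<Sum>j<k. 2)"
      by (intro sum_mono) (auto simp: pair_count_def)
    finally show ?thesis by simp
  qed
  ultimately show ?thesis
    unfolding e2_indicator_decomposition[abs_def]
    by (intro low_tensor_add low_tensor_uminus low_tensor_sum low_tensor_monomial low_tensor_inv_monomials) auto
qed

end

section \<open>\<open>e_2\<close> of three terms of a sequence\<close>

lemma esym_2_triple: "esym 2 [a, b, c] = a * b + b * c + c * a"
proof -
  have "{I. I \<subseteq> {..<length [a, b, c]} \<and> card I = 2} = {{0, 1}, {1, 2}, {2, 0}}"
  proof (intro equalityI subsetI)
    fix I assume "I \<in> {I. I \<subseteq> {..<length [a, b, c]} \<and> card I = 2}"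
    then obtain i j where "I = {i, j}" "i \<noteq> j" "i < 3" "j < 3"
      by (auto simp: card_2_iff)
    moreover have "i \<in> {0, 1, 2}" "j \<in> {0, 1, 2}"
      using \<open>i < 3\<close> \<open>j < 3\<close> by auto
    ultimately show "I \<in> {{0, 1}, {1, 2}, {2, 0}}" by fastforce
  qed auto
  moreover have "{0::nat, 1} \<noteq> {1, 2}" "{0::nat, 1} \<noteq> {2, 0}" "{1::nat, 2} \<noteq> {2, 0}"
    by (auto simp: doubleton_eq_iff)
  ultimately show ?thesis
    by (simp add: esym_def add.assoc)
qed

text \<open>Sorting the positions only permutes the three values, and \<open>e_2\<close> is
  symmetric.\<close>

lemma esym_2_subsequence:
  assumes "distinct [p, q, r]"
  shows "esym 2 (map ((!) S) (sorted_list_of_set {p, q, r})) = S ! p * S ! q + S ! q * S ! r + S ! r * S ! p"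
proof -
  define ps where "ps = sorted_list_of_set {p, q, r}"
  have "length ps = 3" and set: "set ps = {p, q, r}" and dist: "distinct ps"
    using assms by (auto simp: ps_def)
  then obtain a b c where ps: "ps = [a, b, c]"
    by (auto simp: numeral_3_eq_3 length_Suc_conv)
  have "a \<in> {p, q, r}" "b \<in> {p, q, r}" "c \<in> {p, q, r}" using set ps by auto
  then have "esym 2 (map ((!) S) ps) = S ! p * S ! q + S ! q * S ! r + S ! r * S ! p"
    using dist assms unfolding ps by (auto simp: esym_2_triple algebra_simps)
  then show ?thesis by (simp add: ps_def)
qed

section \<open>Absorbing the polynomial factor\<close>

text \<open>Divided by \<open>c ^ n\<close>, the left side tends to 0, since \<open>C / c\<close>
  and \<open>1 / c\<close> are below 1.\<close>

lemma eventually_linear_times_power_le_power: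
  fixes C c K :: real
  assumes "0 \<le> C" "C < c" "1 < c"
  shows "eventually (\<lambda>n. K * (real n + 1) * C ^ n + 1 \<le> c ^ n) at_top"
proof -
  have "norm (C / c) < 1" "norm (1 / c) < 1" using assms by auto
  then have "(\<lambda>n. K * (real n * (C / c) ^ n + (C / c) ^ n) + (1 / c) ^ n) \<longlonglongrightarrow> K * (0 + 0) + 0"
    by (intro tendsto_intros powser_times_n_limit_0 LIMSEQ_power_zero)
  then have "eventually (\<lambda>n. K * (real n * (C / c) ^ n + (C / c) ^ n) + (1 / c) ^ n < 1) at_top"
    by (rule order_tendstoD) simp
  then show ?thesis
  proof eventually_elim
    case (elim n)
    have scale: "(C / c) ^ n * c ^ n = C ^ n" "(1 / c) ^ n * c ^ n = 1"
      using assms by (simp_all add: power_divide)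
    have "(K * (real n * (C / c) ^ n + (C / c) ^ n) + (1 / c) ^ n) * c ^ n
        = K * (real n * ((C / c) ^ n * c ^ n) + (C / c) ^ n * c ^ n) + (1 / c) ^ n * c ^ n"
      by (simp only: distrib_left distrib_right mult.assoc)
    also have "\<dots> = K * (real n + 1) * C ^ n + 1"
      unfolding scale by (simp add: algebra_simps)
    finally have "K * (real n + 1) * C ^ n + 1
        = (K * (real n * (C / c) ^ n + (C / c) ^ n) + (1 / c) ^ n) * c ^ n" ..
    also have "\<dots> \<le> 1 * c ^ n"
      using elim assms by (intro mult_right_mono) auto
    finally show ?case by simp
  qed
qed

section \<open>Bounding the EGZ constant\<close>

context
  fixes k :: nat and field_type :: "'a::{field,finite} itself"
  assumes card: "CARD('a) = 3 ^ k"
begin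

text \<open>In characteristic 3 the last hypothesis reads \<open>x * (x - y) = 0\<close>, so the
  support of \<open>x\<close> lies in that of \<open>y\<close>; equal sizes make the supports
  coincide.\<close>

lemma eq_if_e2_zero:
  fixes x y :: "nat \<Rightarrow> 'a"
  assumes "x \<in> Fpow n" "y \<in> Fpow n" and supp: "card {l. x l \<noteq> 0} = card {l. y l \<noteq> 0}"
    and e2: "\<And>l. x l * x l + x l * y l + y l * x l = 0"
  shows "x = y"
proof -
  have eq: "x l = 0 \<or> x l = y l" for l
  proof -
    have "x l * (x l - y l) = x l * x l + x l * y l + y l * x l - 3 * (x l * y l)"
      by (simp add: algebra_simps)
    then show ?thesis using e2[of l] three_eq_zero[OF card] by auto
  qed
  have "{l. y l \<noteq> 0} \<subseteq> {..<n}"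
    using assms(2) by (auto simp: Fpow_def not_less[symmetric])
  then have "{l. x l \<noteq> 0} = {l. y l \<noteq> 0}"
    using eq supp by (intro card_subset_eq) (auto intro: finite_subset, metis)
  show ?thesis
  proof
    fix l
    have "x l \<noteq> 0 \<longleftrightarrow> y l \<noteq> 0"
      using \<open>{l. x l \<noteq> 0} = {l. y l \<noteq> 0}\<close> by blast
    then show "x l = y l" using eq[of l] by auto
  qed
qed

text \<open>The product of \<open>e2_indicator\<close> over the coordinates detects
  \<open>e_2 = 0\<close> for vectors. On \<open>A\<close> this leaves only constant triples:
  \<open>free\<close> excludes distinct entries, and \<open>supp\<close> excludes exactly two equal
  ones.\<close>

lemma card_e2_free_le:
  fixes A :: "(nat \<Rightarrow> 'a) set" and u :: real
  assumes "finite A" "A \<subseteq> Fpow n" and supp: "\<And>x. x \<in> A \<Longrightarrow> card {l. x l \<noteq> 0} = w"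
    and free: "\<And>x y z. x \<in> A \<Longrightarrow> y \<in> A \<Longrightarrow> z \<in> A \<Longrightarrow> distinct [x, y, z] \<Longrightarrow> x * y + y * z + z * x \<noteq> 0"
    and u: "0 < u" "u \<le> 1"
  shows "real (card A) \<le> 3 * (((1 + u ^ 3 + u ^ 6) ^ k - u ^ (6 * k) + u ^ (2 * k)) / u ^ (2 * k)) ^ n"
proof -
  have eqI: "x = y" if "x \<in> A" "y \<in> A" "\<And>l. x l * x l + x l * y l + y l * x l = 0" for x y
    using that assms(2) supp by (intro eq_if_e2_zero[of x n y]) auto
  have diag: "(\<forall>l<n. e2_indicator (x l) (y l) (z l) \<noteq> 0) \<longleftrightarrow> x = y \<and> y = z"
    if A: "x \<in> A" "y \<in> A" "z \<in> A" for x y z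
  proof
    assume "\<forall>l<n. e2_indicator (x l) (y l) (z l) \<noteq> 0"
    then have "x l * y l + y l * z l + z l * x l = 0" if "l < n" for l
      using that by (auto simp: e2_indicator_def split: if_splits)
    moreover have "x l * y l + y l * z l + z l * x l = 0" if "l \<ge> n" for l
      using that A[THEN subsetD[OF assms(2)]] by (simp add: Fpow_def)
    ultimately have e2: "x l * y l + y l * z l + z l * x l = 0" for l
      by (meson not_less)
    then have "x * y + y * z + z * x = 0" by (intro ext) simp
    then have "\<not> distinct [x, y, z]" using free A by blast
    \<comment> \<open>By cyclic symmetry each case has the form treated in \<open>eqI\<close>, with
      the repeated entry first.\<close>
    then consider "x = y" | "y = z" | "z = x" by auto
    then show "x = y \<and> y = z"
    proof cases
      case 1
      then show ?thesis using eqI[of x z] A e2 by (simp add: add_ac)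
    next
      case 2
      then show ?thesis using eqI[of y x] A e2 by (simp add: add_ac)
    next
      case 3
      then show ?thesis using eqI[of z y] A e2 by (simp add: add_ac)
    qed
  next
    assume "x = y \<and> y = z"
    moreover have "a * a + a * a + a * a = 0" for a :: 'a
      using three_eq_zero[OF card] by (simp flip: distrib_right mult_numeral_1 numeral_Bit1)
    ultimately show "\<forall>l<n. e2_indicator (x l) (y l) (z l) \<noteq> 0"
      by (simp add: e2_indicator_def)
  qed
  have "real (card A) \<le> 3 * real (card (low_words (basis_index k) (weight k) (2 * k) n))"
    using card_le_low_tensor_power[OF finite_basis_index assms(1) low_tensor_e2_indicator[OF card] diag]
    by linarith
  also have "\<dots> \<le> 3 * ((\<Sum>i\<in>basis_index k. u ^ weight k i) / u ^ (2 * k)) ^ n"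
    using card_low_words_le[OF finite_basis_index u] by simp
  finally show ?thesis unfolding sum_power_weight .
qed

text \<open>The factor 6 is 2 times 3: each vector occurs at most twice, and each of the
  \<open>n + 1\<close> support sizes admits at most \<open>3 * C ^ n\<close> vectors.\<close>

lemma EGZ_prop_Fpow:
  fixes u :: real
  defines "C \<equiv> ((1 + u ^ 3 + u ^ 6) ^ k - u ^ (6 * k) + u ^ (2 * k)) / u ^ (2 * k)"
  assumes u: "0 < u" "u \<le> 1" and m: "6 * (real n + 1) * C ^ n < real m"
  shows "EGZ_prop 3 (Fpow n :: (nat \<Rightarrow> 'a) set) 2 m"
  unfolding EGZ_prop_def
proof (intro allI impI)
  fix S :: "(nat \<Rightarrow> 'a) list"
  assume S: "set S \<subseteq> Fpow n \<and> m \<le> length S"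
  show "\<exists>I\<subseteq>{..<length S}. card I = 3 \<and> esym 2 (map ((!) S) (sorted_list_of_set I)) = 0"
  proof (rule ccontr)
    assume contra: "\<not> ?thesis"
    have no_triple: "S ! p * S ! q + S ! q * S ! r + S ! r * S ! p \<noteq> 0"
      if "distinct [p, q, r]" "p < length S" "q < length S" "r < length S" for p q r
    proof -
      have "card {p, q, r} = 3" using that by simp
      then show ?thesis
        using contra that esym_2_subsequence[OF that(1), of S] by (metis insert_subset empty_subsetI lessThan_iff)
    qed
    have count: "count_list S x \<le> 2" for x
    proof (rule ccontr)
      assume "\<not> count_list S x \<le> 2"
      then have "3 \<le> card {i. i < length S \<and> S ! i = x}"
        by (simp add: count_list_eq_length_filter length_filter_conv_card eq_commute)
      then obtain I where I: "I \<subseteq> {i. i < length S \<and> S ! i = x}" "card I = 3"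
        by (meson obtain_subset_with_card_n)
      then obtain p q r where pqr: "I = {p, q, r}" "distinct [p, q, r]"
        by (auto simp: card_3_iff)
      have "x * x + x * x + x * x = 0"
        using three_eq_zero[OF card] by (intro ext) (simp flip: distrib_right mult_numeral_1 numeral_Bit1)
      then show False using no_triple[OF pqr(2)] I pqr(1) by auto
    qed
    define A where "A w = {x \<in> set S. card {l. x l \<noteq> 0} = w}" for w
    have card_A: "real (card (A w)) \<le> 3 * C ^ n" for w
      unfolding C_def
    proof (rule card_e2_free_le[OF _ _ _ _ u])
      show "A w \<subseteq> Fpow n" using S by (auto simp: A_def)
      show "x * y + y * z + z * x \<noteq> 0" if "x \<in> A w" "y \<in> A w" "z \<in> A w" "distinct [x, y, z]" for x y z
      proof -
        have "x \<in> set S" "y \<in> set S" "z \<in> set S" using that by (auto simp: A_def)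
        then obtain p q r where "p < length S" "q < length S" "r < length S" "x = S ! p" "y = S ! q" "z = S ! r"
          by (metis in_set_conv_nth)
        then show ?thesis using no_triple[of p q r] that(4) by auto
      qed
    qed (auto simp: A_def)
    have "set S \<subseteq> (\<Union>w\<le>n. A w)"
    proof
      fix x assume x: "x \<in> set S"
      then have "{l. x l \<noteq> 0} \<subseteq> {..<n}"
        using S by (auto simp: Fpow_def not_less[symmetric])
      then have "card {l. x l \<noteq> 0} \<le> n"
        using card_mono[of "{..<n}"] by auto
      then show "x \<in> (\<Union>w\<le>n. A w)" using x by (auto simp: A_def)
    qed
    then have "card (set S) \<le> card (\<Union>w\<le>n. A w)"
      by (intro card_mono) (auto simp: A_def)
    also have "\<dots> \<le> (\<Sum>w\<le>n. card (A w))"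
      by (intro card_UN_le) auto
    also have "real (\<Sum>w\<le>n. card (A w)) \<le> (\<Sum>w\<le>n. 3 * C ^ n)"
      unfolding of_nat_sum by (intro sum_mono card_A)
    finally have "real (card (set S)) \<le> (real n + 1) * (3 * C ^ n)" by (simp add: add.commute)
    then have "2 * real (card (set S)) \<le> 6 * (real n + 1) * C ^ n" by (simp add: algebra_simps)
    moreover have "length S \<le> 2 * card (set S)"
    proof -
      have "length S = (\<Sum>x\<in>set S. count_list S x)" by (simp add: sum_count_set)
      also have "\<dots> \<le> (\<Sum>x\<in>set S. 2)" by (intro sum_mono count)
      finally show ?thesis by simp
    qed
    moreover have "m \<le> length S" using S ..
    ultimately show False using m by linarith
  qed
qed

lemma eventually_EGZ_Fpow_le:
  fixes u c :: real
  assumes u: "0 < u" "u \<le> 1" and "1 < c"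
    and c: "((1 + u ^ 3 + u ^ 6) ^ k - u ^ (6 * k) + u ^ (2 * k)) / u ^ (2 * k) < c"
  shows "\<forall>\<^sub>F n in at_top. \<exists>l. EGZ 3 (Fpow n :: (nat \<Rightarrow> 'a) set) 2 = enat l \<and> real l \<le> c ^ n"
proof -
  define C where "C = ((1 + u ^ 3 + u ^ 6) ^ k - u ^ (6 * k) + u ^ (2 * k)) / u ^ (2 * k)"
  have "u ^ (6 * k) \<le> (1 + u ^ 3 + u ^ 6) ^ k"
    unfolding power_mult using u by (intro power_mono) auto
  then have "0 \<le> C" using u by (auto simp: C_def intro!: divide_nonneg_pos add_nonneg_pos)
  then have "eventually (\<lambda>n. 6 * (real n + 1) * C ^ n + 1 \<le> c ^ n) at_top"
    using assms by (intro eventually_linear_times_power_le_power) (simp_all add: C_def)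
  then show ?thesis
  proof eventually_elim
    case (elim n)
    \<comment> \<open>Adding 1 to the floor makes \<open>m\<close> positive and strictly larger than
      the bound.\<close>
    define m where "m = nat \<lfloor>6 * (real n + 1) * C ^ n\<rfloor> + 1"
    define P where "P l \<longleftrightarrow> l > 0 \<and> EGZ_prop 3 (Fpow n :: (nat \<Rightarrow> 'a) set) 2 l" for l
    have "0 \<le> 6 * (real n + 1) * C ^ n" using \<open>0 \<le> C\<close> by simp
    then have m: "6 * (real n + 1) * C ^ n < real m" "real m \<le> 6 * (real n + 1) * C ^ n + 1"
      unfolding m_def by linarith+
    then have "P m"
      using EGZ_prop_Fpow[OF u, of n m] by (simp add: P_def C_def m_def)
    then have "EGZ 3 (Fpow n :: (nat \<Rightarrow> 'a) set) 2 = enat (LEAST l. P l)" "(LEAST l. P l) \<le> m"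
      by (auto simp: EGZ_def P_def intro: Least_le)
    then show ?case using m(2) elim by (intro exI[of _ "LEAST l. P l"]) linarith
  qed
qed

end

section \<open>Numerical evaluation of the growth rate\<close>

theorem theorem4p13:
  fixes k :: nat and c :: real
  assumes "CARD('a::{field,finite}) = 3 ^ k"
    and "(k = 2 \<and> c = 8.315) \<or> (k = 3 \<and> c = 21.802) \<or>
         (k = 4 \<and> c = 58.557) \<or> (k = 5 \<and> c = 159.812)"
  shows "\<exists>f :: nat \<Rightarrow> real. f \<in> o(\<lambda>n. real n) \<and>
           (\<forall>\<^sub>F n in at_top. \<exists>l. EGZ 3 (Fpow n :: (nat \<Rightarrow> 'a) set) 2 = enat l \<and>
                                   real l \<le> c powr (real n + f n))"
proof -
  \<comment> \<open>The witnesses are rational points near the minimum of the growth rate. From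
    \<open>k = 3\<close> on one point serves: the dominant term is the \<open>k\<close>-th power of
    \<open>(1 + u ^ 3 + u ^ 6) / u ^ 2\<close>, which is smallest near
    \<open>u = 0.84\<close>.\<close>
  have "\<exists>u::real. 0 < u \<and> u \<le> 1 \<and>
      ((1 + u ^ 3 + u ^ 6) ^ k - u ^ (6 * k) + u ^ (2 * k)) / u ^ (2 * k) < c"
    using assms(2)
  proof (elim disjE conjE)
    assume kc: "k = 2" "c = 8.315"
    show ?thesis unfolding kc by (intro exI[of _ "87 / 100"]) (simp add: power_divide)
  next
    assume kc: "k = 3" "c = 21.802"
    show ?thesis unfolding kc by (intro exI[of _ "21 / 25"]) (simp add: power_divide)
  next
    assume kc: "k = 4" "c = 58.557"
    show ?thesis unfolding kc by (intro exI[of _ "21 / 25"]) (simp add: power_divide)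
  next
    assume kc: "k = 5" "c = 159.812"
    show ?thesis unfolding kc by (intro exI[of _ "21 / 25"]) (simp add: power_divide)
  qed
  then obtain u :: real where u: "0 < u" "u \<le> 1"
    and C: "((1 + u ^ 3 + u ^ 6) ^ k - u ^ (6 * k) + u ^ (2 * k)) / u ^ (2 * k) < c"
    by blast
  have "1 < c" using assms(2) by auto
  from eventually_EGZ_Fpow_le[OF assms(1) u this C]
  have "\<forall>\<^sub>F n in at_top. \<exists>l. EGZ 3 (Fpow n :: (nat \<Rightarrow> 'a) set) 2 = enat l \<and> real l \<le> c powr (real n + 0)"
    using \<open>1 < c\<close> by (simp add: powr_realpow)
  \<comment> \<open>The strict gap below \<open>c\<close> has absorbed all lower-order factors, so
    the error exponent can be 0.\<close>
  then show ?thesis by (intro exI[of _ "\<lambda>_. 0"]) simp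
qed

end
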